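(* Let $k$ be an odd positive integer and let $G$ be a $k$-tree. Then $\mathrm{T}(G)=\frac{k+1}{2}$.
   Context: All graphs are finite, simple and undirected. A $k$-tree is a graph obtained by starting from the complete graph $K_{k+1}$ and repeatedly adding a new vertex adjacent to exactly the vertices of some existing clique on $k$ vertices. The tree cover number $\mathrm{T}(G)$ is the minimum number of vertex-disjoint induced trees of $G$ covering $V(G)$. *)

theory Defs
  imports "Graph_Theory.Graph_Theory" "HOL-Library.Disjoint_Sets"
begin

text \<open>
  A finite simple undirected graph is a \<^locale>\<open>pair_graph\<close>: a finite, loop-free digraph without
  parallel arcs whose arc relation is symmetric, the edge \<open>{u, v}\<close> being the pair of arcs
  \<open>(u, v)\<close> and \<open>(v, u)\<close>.
\<close>

definition is_clique :: "'a pair_pre_digraph \<Rightarrow> 'a set \<Rightarrow> bool" where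
  "is_clique G C \<longleftrightarrow> C \<subseteq> pverts G \<and> (\<forall>u \<in> C. \<forall>v \<in> C. u \<noteq> v \<longrightarrow> (u, v) \<in> parcs G)"

definition add_vert_adjacent :: "'a pair_pre_digraph \<Rightarrow> 'a \<Rightarrow> 'a set \<Rightarrow> 'a pair_pre_digraph" where
  "add_vert_adjacent G v C =
     \<lparr> pverts = insert v (pverts G), parcs = parcs G \<union> {v} \<times> C \<union> C \<times> {v} \<rparr>"

inductive k_tree :: "nat \<Rightarrow> 'a pair_pre_digraph \<Rightarrow> bool" for k :: nat where
  complete: "complete_digraph (k + 1) (with_proj G) \<Longrightarrow> k_tree k G"
| add_vert: "k_tree k G \<Longrightarrow> v \<notin> pverts G \<Longrightarrow> is_clique G C \<Longrightarrow> card C = k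
    \<Longrightarrow> k_tree k (add_vert_adjacent G v C)"

text \<open>
  The library's \<^const>\<open>tree\<close> is not usable for undirected graphs: in a symmetric digraph every edge
  yields a directed cycle of length 2, so only edgeless graphs are forests. The cycles of the
  undirected graph are the directed cycles of length at least 3. Note that \<^const>\<open>connected\<close>
  requires a nonempty vertex set.
\<close>

definition undirected_tree :: "('a, 'b) pre_digraph \<Rightarrow> bool" where
  "undirected_tree H \<longleftrightarrow>
     graph H \<and> connected H \<and> \<not> (\<exists>p. pre_digraph.cycle H p \<and> 3 \<le> length p)"

text \<open>
  An induced subgraph is determined by its vertex set, so a cover by vertex-disjoint induced trees
  is a partition of the vertex set into sets each of which induces a tree.
\<close>

definition is_tree_cover :: "'a pair_pre_digraph \<Rightarrow> 'a set set \<Rightarrow> bool" where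
  "is_tree_cover G P \<longleftrightarrow>
     partition_on (pverts G) P \<and> (\<forall>X \<in> P. undirected_tree (with_proj G \<restriction> X))"

definition tree_cover_number :: "'a pair_pre_digraph \<Rightarrow> nat" where
  "tree_cover_number G = (LEAST n. \<exists>P. is_tree_cover G P \<and> card P = n)"

lemma k_tree_imp_pair_graph:
  assumes "k_tree k G"
  shows "pair_graph G"
  using assms
proof induction
  case (complete G)
  then show ?case by (rule pair_graphI_complete)
next
  case (add_vert G v C)
  interpret pair_graph G by fact
  have C: "C \<subseteq> pverts G" using add_vert.hyps by (simp add: is_clique_def)
  then have "finite C" using pair_finite_verts finite_subset by blast
  with C \<open>v \<notin> pverts G\<close> show ?case
    by unfold_locales
      (auto simp: add_vert_adjacent_def symmetric_def sym_def pair_finite_verts pair_finite_arcs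
        dest: in_arcsD1 in_arcsD2 arcs_symmetric pair_no_loops)
qed

end

theory Submission
  imports Defs
begin

text \<open>
  A tree contains at most two vertices of a clique, so covering a clique on \<open>k + 1\<close> vertices takes at
  least \<open>(k + 1) div 2\<close> trees. Conversely, pair up the vertices of the initial complete graph and
  extend the cover along the construction: a clique on \<open>k = 2 * m - 1\<close> vertices meets exactly one of
  the \<open>m\<close> trees in a single vertex, and the new vertex can be attached to that tree as a leaf.
\<close>

section \<open>Induced subgraphs and vertex additions as pair graphs\<close>

text \<open>The operation \<open>\<restriction>\<close> yields a general digraph; this version stays
  in \<open>pair_pre_digraph\<close>, so that \<open>add_vert_adjacent\<close> can be applied to its
  result.\<close>

definition induced :: "'a pair_pre_digraph \<Rightarrow> 'a set \<Rightarrow> 'a pair_pre_digraph" where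
  "induced G X = \<lparr> pverts = X, parcs = parcs G \<inter> X \<times> X \<rparr>"

lemma induced_simps [simp]:
  "pverts (induced G X) = X" "parcs (induced G X) = parcs G \<inter> X \<times> X"
  by (simp_all add: induced_def)

lemma induce_subgraph_with_proj: "with_proj G \<restriction> X = with_proj (induced G X)"
  by (auto simp: induce_subgraph_def induced_def with_proj_def)

lemma pair_graphI:
  assumes "finite (pverts G)" "sym (parcs G)"
    and "\<And>u v. (u, v) \<in> parcs G \<Longrightarrow> u \<in> pverts G \<and> v \<in> pverts G \<and> u \<noteq> v"
  shows "pair_graph G"
proof -
  have "parcs G \<subseteq> pverts G \<times> pverts G" using assms(3) by auto
  then have "finite (parcs G)" using assms(1) by (meson finite_SigmaI finite_subset)
  then show ?thesis using assms by unfold_locales (auto simp: symmetric_def)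
qed

lemma pair_graph_sym:
  assumes "pair_graph G"
  shows "sym (parcs G)"
proof -
  interpret pair_graph G by fact
  show ?thesis using pair_sym_arcs by (simp add: symmetric_def)
qed

lemma pair_graph_arcsD:
  assumes "pair_graph G" "(u, v) \<in> parcs G"
  shows "u \<in> pverts G" "v \<in> pverts G" "u \<noteq> v" "(v, u) \<in> parcs G"
proof -
  interpret pair_graph G by fact
  show "u \<in> pverts G" "v \<in> pverts G" "u \<noteq> v" "(v, u) \<in> parcs G"
    using assms(2) in_arcsD1 in_arcsD2 pair_no_loops arcs_symmetric by fastforce+
qed

lemma pair_graph_finite:
  assumes "pair_graph G"
  shows "finite (pverts G)"
proof -
  interpret pair_graph G by fact
  show ?thesis by (rule pair_finite_verts)
qed

lemma pair_graph_induced: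
  assumes "pair_graph G" "X \<subseteq> pverts G"
  shows "pair_graph (induced G X)"
  using assms pair_graph_arcsD[OF assms(1)] finite_subset[OF assms(2) pair_graph_finite]
  by (intro pair_graphI) (auto simp: sym_def)

lemma pair_graph_add_vert_adjacent:
  assumes "pair_graph G" "v \<notin> pverts G" "C \<subseteq> pverts G"
  shows "pair_graph (add_vert_adjacent G v C)"
proof (rule pair_graphI)
  show "finite (pverts (add_vert_adjacent G v C))"
    using pair_graph_finite[OF assms(1)] by (simp add: add_vert_adjacent_def)
  show "sym (parcs (add_vert_adjacent G v C))"
    using pair_graph_sym[OF assms(1)] by (auto simp: add_vert_adjacent_def sym_def)
  fix x y assume "(x, y) \<in> parcs (add_vert_adjacent G v C)"
  then consider "(x, y) \<in> parcs G" | "x = v" "y \<in> C" | "x \<in> C" "y = v"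
    by (auto simp: add_vert_adjacent_def)
  then show "x \<in> pverts (add_vert_adjacent G v C) \<and> y \<in> pverts (add_vert_adjacent G v C) \<and> x \<noteq> y"
    by cases (use assms(2,3) pair_graph_arcsD[OF assms(1)] in \<open>auto simp: add_vert_adjacent_def\<close>)
qed

lemma induced_add_vert_adjacent:
  "v \<notin> X \<Longrightarrow> induced (add_vert_adjacent G v C) X = induced G X"
  by (auto simp: induced_def add_vert_adjacent_def)

text \<open>No arc of \<open>G\<close> touches \<open>v\<close>, so the only arcs at
  \<open>v\<close> are the new ones, cut down to \<open>X \<inter> C\<close>. When this intersection
  is a single vertex, \<open>v\<close> becomes a leaf.\<close>

lemma induced_add_vert_adjacent_insert:
  assumes "pair_graph G" "v \<notin> pverts G" "C \<subseteq> pverts G"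
  shows "induced (add_vert_adjacent G v C) (insert v X) =
    add_vert_adjacent (induced G X) v (X \<inter> C)"
proof -
  have "parcs G \<inter> insert v X \<times> insert v X = parcs G \<inter> X \<times> X"
    using pair_graph_arcsD(1,2)[OF assms(1)] assms(2) by blast
  then show ?thesis
    using assms(2,3) by (simp add: induced_def add_vert_adjacent_def Int_Un_distrib2) blast
qed

section \<open>Connectedness and cycles in terms of the arc relation\<close>

text \<open>By symmetry the symmetric closure adds nothing, and arcs never leave the vertex set, so
  the closure restricted to the vertices is the ordinary one.\<close>

lemma pair_graph_connected_iff:
  assumes "pair_graph G"
  shows "connected (with_proj G) \<longleftrightarrow>
    pverts G \<noteq> {} \<and> (\<forall>u \<in> pverts G. \<forall>v \<in> pverts G. (u, v) \<in> (parcs G)\<^sup>*)"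
proof -
  have "symcl (parcs G) = parcs G"
    using pair_graph_sym[OF assms] by (auto simp: symcl_def sym_def)
  moreover have "(u, v) \<in> rtrancl_on (pverts G) (parcs G) \<longleftrightarrow> (u, v) \<in> (parcs G)\<^sup>*"
    if "u \<in> pverts G" for u v
  proof
    assume "(u, v) \<in> (parcs G)\<^sup>*"
    then show "(u, v) \<in> rtrancl_on (pverts G) (parcs G)"
      by induction (use that pair_graph_arcsD[OF assms] in
        \<open>auto intro: rtrancl_on_into_rtrancl_on\<close>)
  qed (rule rtrancl_on_rtranclI)
  ultimately show ?thesis by (auto simp: connected_conv)
qed

text \<open>The vertices of a walk after its start are the heads of its arcs, which turns the
  distinctness condition into one on \<open>map snd p\<close>.\<close>

lemma cycle_with_proj_iff:
  "pre_digraph.cycle (with_proj G) p \<longleftrightarrow>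
    (\<exists>u \<in> pverts G. set p \<subseteq> parcs G \<and> pcas u p u \<and> p \<noteq> [] \<and> distinct (map snd p))"
proof -
  have "tl (pawalk_verts u p) = map snd p" if "pcas u p v" for u v
    using pre_digraph.awalk_verts_conv'[of "with_proj G" u p v] that
    by (auto simp: cas_with_proj_eq awalk_verts_with_proj_eq split: if_splits)
  then show ?thesis
    by (auto simp: pre_digraph.cycle_def pre_digraph.awalk_def cas_with_proj_eq
        awalk_verts_with_proj_eq)
qed

lemma pcas_append: "pcas u (p @ q) v \<longleftrightarrow> (\<exists>w. pcas u p w \<and> pcas w q v)"
  by (induction u p v rule: pcas.induct) auto

lemma pcas_last: "pcas u p v \<Longrightarrow> p \<noteq> [] \<Longrightarrow> snd (last p) = v"
  by (induction u p v rule: pcas.induct) auto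

text \<open>Rotate the cycle so that it starts at \<open>v\<close>: its second vertex and its last but one
  vertex are then both \<open>c\<close>.\<close>
lemma closed_walk_avoids_leaf:
  assumes p: "pcas u p u" "distinct (map snd p)" "3 \<le> length p" "e \<in> set p"
    and leaf: "\<And>x. (v, x) \<in> set p \<Longrightarrow> x = c" "\<And>x. (x, v) \<in> set p \<Longrightarrow> x = c"
  shows "fst e \<noteq> v"
proof
  assume "fst e = v"
  with leaf(1) p(4) have e: "e = (v, c)" by (cases e) auto
  obtain xs ys where xy: "p = xs @ e # ys" using split_list[OF p(4)] by blast
  define q where "q = ys @ xs"
  have q: "pcas c q v" using p(1) by (auto simp: xy q_def pcas_append e)
  have "set q \<subseteq> set p" "distinct (c # map snd q)" "2 \<le> length q"
    using p(2,3) by (auto simp: xy q_def e)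
  then have "q \<noteq> []" by auto
  then obtain r f where r: "q = r @ [f]" by (metis rev_exhaust)
  have "snd f = v" using pcas_last[OF q \<open>q \<noteq> []\<close>] r by simp
  then have "f = (c, v)"
    using leaf(2)[of "fst f"] \<open>set q \<subseteq> set p\<close> r by (cases f) auto
  then have "pcas c r c" using q by (auto simp: r pcas_append)
  \<comment> \<open>Here length at least 3 matters: the 2-cycle along a single edge would leave
    \<open>r\<close> empty. A nonempty \<open>r\<close> ends in \<open>c\<close>, which is already
    the head of \<open>e\<close>.\<close>
  moreover have "r \<noteq> []" using \<open>2 \<le> length q\<close> r by auto
  ultimately have "c \<in> snd ` set r" using pcas_last last_in_set by (metis image_eqI)
  then show False using \<open>distinct (c # map snd q)\<close> r by auto
qed

section \<open>Building trees by attaching leaves\<close>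

text \<open>Any two vertices are joined through \<open>c\<close>. A cycle of length at least 3
  cannot visit the leaf \<open>v\<close>, so it would already be a cycle of
  \<open>G\<close>.\<close>

lemma undirected_tree_add_leaf:
  assumes "pair_graph G" "undirected_tree (with_proj G)" "v \<notin> pverts G" "c \<in> pverts G"
  shows "undirected_tree (with_proj (add_vert_adjacent G v {c}))"
    (is "undirected_tree (with_proj ?H)")
proof -
  have V: "pverts ?H = insert v (pverts G)"
    and A: "parcs ?H = parcs G \<union> {(v, c), (c, v)}"
    by (auto simp: add_vert_adjacent_def)
  have H: "pair_graph ?H"
    using assms by (intro pair_graph_add_vert_adjacent) auto
  interpret H: pair_graph ?H by fact
  have conn: "(u, w) \<in> (parcs G)\<^sup>*" if "u \<in> pverts G" "w \<in> pverts G" for u w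
    using assms(2) that by (auto simp: undirected_tree_def pair_graph_connected_iff[OF assms(1)])
  have mono: "(parcs G)\<^sup>* \<subseteq> (parcs ?H)\<^sup>*" by (rule rtrancl_mono) (auto simp: A)
  have "(u, c) \<in> (parcs ?H)\<^sup>*" "(c, u) \<in> (parcs ?H)\<^sup>*" if "u \<in> pverts ?H" for u
    using that conn[of u c] conn[of c u] mono assms(4) by (auto simp: V A)
  then have "connected (with_proj ?H)"
    unfolding pair_graph_connected_iff[OF H] using V by (blast intro: rtrancl_trans)
  moreover have False if p: "pre_digraph.cycle (with_proj ?H) p" "3 \<le> length p" for p
  proof -
    obtain u where u: "u \<in> pverts ?H" "set p \<subseteq> parcs ?H" "pcas u p u" "distinct (map snd p)" "p \<noteq> []"
      using p(1) unfolding cycle_with_proj_iff by blast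
    have leaf: "x = c" if "(v, x) \<in> set p \<or> (x, v) \<in> set p" for x
      using that u(2) A pair_graph_arcsD[OF assms(1)] assms(3) by blast
    have no_fst: "fst e \<noteq> v" if "e \<in> set p" for e
      using closed_walk_avoids_leaf[OF u(3,4) p(2) that] leaf by metis
    then have "u \<noteq> v" using u(3,5) by (cases p) auto
    \<comment> \<open>The head of an arc is the tail of the next arc or, for the last arc, the start
      \<open>u\<close>; neither can be \<open>v\<close>.\<close>
    have "snd e \<noteq> v" if e: "e \<in> set p" for e
    proof
      assume "snd e = v"
      obtain xs ys where xy: "p = xs @ e # ys" using split_list[OF e] by blast
      show False
      proof (cases ys)
        case Nil
        then show False using pcas_last[OF u(3,5)] xy \<open>snd e = v\<close> \<open>u \<noteq> v\<close> by simp
      next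
        case (Cons f zs)
        then have "fst f = v" using u(3) xy \<open>snd e = v\<close> by (auto simp: pcas_append)
        then show False using no_fst[of f] xy Cons by simp
      qed
    qed
    with no_fst u(2) have "set p \<subseteq> parcs G" by (fastforce simp: A)
    moreover have "u \<in> pverts G" using u(1) V \<open>u \<noteq> v\<close> by auto
    ultimately have "pre_digraph.cycle (with_proj G) p"
      unfolding cycle_with_proj_iff using u by blast
    then show False using assms(2) p(2) by (auto simp: undirected_tree_def)
  qed
  ultimately show ?thesis
    unfolding undirected_tree_def using H.graph_axioms by blast
qed

lemma undirected_tree_singleton:
  assumes "pair_graph G" "v \<in> pverts G"
  shows "undirected_tree (with_proj (induced G {v}))"
proof -
  have H: "pair_graph (induced G {v})" using assms by (intro pair_graph_induced) auto
  interpret H: pair_graph "induced G {v}" by fact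
  have no: "parcs (induced G {v}) = {}" using pair_graph_arcsD(3)[OF assms(1)] by auto
  show ?thesis
    unfolding undirected_tree_def pair_graph_connected_iff[OF H] cycle_with_proj_iff no
    using H.graph_axioms by auto
qed

section \<open>Lower bound from cliques\<close>

text \<open>Three common vertices would span a triangle, a cycle of length 3 in the induced
  subgraph.\<close>

lemma undirected_tree_inter_clique:
  assumes "pair_graph G" "is_clique G C" "undirected_tree (with_proj G \<restriction> X)"
  shows "card (X \<inter> C) \<le> 2"
proof (rule ccontr)
  assume "\<not> card (X \<inter> C) \<le> 2"
  then have "3 \<le> card (X \<inter> C)" by simp
  then obtain T where T: "T \<subseteq> X \<inter> C" "card T = 3" by (meson obtain_subset_with_card_n)
  then obtain x y z where xyz: "T = {x, y, z}" "x \<noteq> y" "y \<noteq> z" "x \<noteq> z"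
    by (auto simp: card_3_iff)
  have "pre_digraph.cycle (with_proj (induced G X)) [(x, y), (y, z), (z, x)]"
    unfolding cycle_with_proj_iff using T(1) xyz assms(2) by (auto simp: is_clique_def)
  then show False using assms(3) unfolding undirected_tree_def induce_subgraph_with_proj
    by (metis One_nat_def Suc_1 length_Cons list.size(3) numeral_3_eq_3 order_refl)
qed

lemma sum_card_inter_partition:
  assumes "finite A" "partition_on A P" "C \<subseteq> A"
  shows "(\<Sum>X\<in>P. card (X \<inter> C)) = card C"
proof -
  have "finite C" using assms finite_subset by blast
  have "C = (\<Union>X\<in>P. X \<inter> C)" using assms by (auto simp: partition_on_def)
  moreover have "card (\<Union>X\<in>P. X \<inter> C) = (\<Sum>X\<in>P. card (X \<inter> C))"
    using assms(2) finite_elements[OF assms(1,2)] \<open>finite C\<close>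
    by (intro card_UN_disjoint) (auto simp: partition_on_def disjoint_def)
  ultimately show ?thesis by simp
qed

lemma card_clique_le_tree_cover:
  assumes "pair_graph G" "is_clique G C" "is_tree_cover G P"
  shows "card C \<le> 2 * card P"
proof -
  have "card C = (\<Sum>X\<in>P. card (X \<inter> C))"
    using assms(2,3) sum_card_inter_partition[OF pair_graph_finite[OF assms(1)]]
    by (auto simp: is_tree_cover_def is_clique_def)
  also have "\<dots> \<le> (\<Sum>X\<in>P. 2)"
    using assms undirected_tree_inter_clique by (intro sum_mono) (auto simp: is_tree_cover_def)
  finally show ?thesis by simp
qed

text \<open>The initial complete graph survives, since adding a vertex removes no arc.\<close>

lemma k_tree_has_clique:
  assumes "k_tree k G"
  shows "\<exists>C. is_clique G C \<and> card C = k + 1"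
  using assms
proof induction
  case (complete G)
  then have "is_clique G (pverts G) \<and> card (pverts G) = k + 1"
    by (auto simp: complete_digraph_def is_clique_def)
  then show ?case by blast
next
  case (add_vert G v C)
  then obtain D where "is_clique G D" "card D = k + 1" by blast
  then have "is_clique (add_vert_adjacent G v C) D"
    by (auto simp: is_clique_def add_vert_adjacent_def)
  with \<open>card D = k + 1\<close> show ?case by blast
qed

section \<open>Upper bound by extending a cover along the construction\<close>

lemma partition_into_pairs:
  assumes "card A = 2 * m" "finite A"
  shows "\<exists>P. partition_on A P \<and> card P = m \<and> (\<forall>X\<in>P. card X = 2)"
  using assms
proof (induction m arbitrary: A)
  case 0
  then show ?case by (auto intro!: exI[of _ "{}"] simp: partition_on_def)
next
  case (Suc m)
  then obtain X where X: "X \<subseteq> A" "card X = 2"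
    by (metis le_add1 mult_Suc_right obtain_subset_with_card_n)
  have "card (A - X) = 2 * m" using Suc.prems X by (simp add: card_Diff_subset finite_subset)
  then obtain P where P: "partition_on (A - X) P" "card P = m" "\<forall>X\<in>P. card X = 2"
    using Suc by blast
  have disj: "disjnt X (\<Union>P)" using P(1) by (auto simp: partition_on_def disjnt_def)
  moreover have "X \<noteq> {}" using X(2) by auto
  ultimately have "X \<notin> P" unfolding disjnt_def by blast
  moreover have "finite P" using P(1) Suc.prems finite_elements by blast
  moreover have "partition_on A (insert X P)"
    using P(1) X by (auto simp: partition_on_insert[OF disj])
  ultimately show ?case using P X by (intro exI[of _ "insert X P"]) auto
qed

text \<open>Each pair spans an edge, which is a one-vertex tree with a leaf attached.\<close>

lemma complete_tree_cover:
  assumes "complete_digraph (2 * m) (with_proj G)"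
  shows "\<exists>P. is_tree_cover G P \<and> card P = m"
proof -
  have G: "pair_graph G" using assms by (rule pair_graphI_complete)
  have A: "parcs G = {(u, v). u \<in> pverts G \<and> v \<in> pverts G \<and> u \<noteq> v}"
    and "card (pverts G) = 2 * m"
    using assms by (auto simp: complete_digraph_def)
  then obtain P where P: "partition_on (pverts G) P" "card P = m" "\<forall>X\<in>P. card X = 2"
    using partition_into_pairs pair_graph_finite[OF G] by blast
  have "undirected_tree (with_proj G \<restriction> X)" if XP: "X \<in> P" for X
  proof -
    obtain v c where X: "X = {v, c}" "v \<noteq> c" using P(3)[rule_format, OF XP] unfolding card_2_iff by blast
    have "X \<subseteq> pverts G" using P(1) XP by (auto simp: partition_on_def)
    with X have "induced G X = add_vert_adjacent (induced G {c}) v {c}"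
      by (auto simp: induced_def add_vert_adjacent_def A)
    moreover have "undirected_tree (with_proj (add_vert_adjacent (induced G {c}) v {c}))"
      using G X \<open>X \<subseteq> pverts G\<close>
      by (intro undirected_tree_add_leaf undirected_tree_singleton pair_graph_induced) auto
    ultimately show ?thesis by (simp add: induce_subgraph_with_proj)
  qed
  with P show ?thesis unfolding is_tree_cover_def by blast
qed

text \<open>Parity is decisive: \<open>C\<close> has one vertex fewer than two per tree, so some
  tree \<open>X\<close> meets it in exactly one vertex \<open>c\<close>. Then \<open>v\<close> joins
  \<open>X\<close> as a leaf at \<open>c\<close>, and the other trees are unchanged.\<close>

lemma tree_cover_add_vert:
  assumes G: "pair_graph G" and P: "is_tree_cover G P"
    and v: "v \<notin> pverts G" and C: "is_clique G C" "card C + 1 = 2 * card P"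
  shows "\<exists>Q. is_tree_cover (add_vert_adjacent G v C) Q \<and> card Q = card P"
proof -
  let ?H = "add_vert_adjacent G v C"
  have part: "partition_on (pverts G) P" and CV: "C \<subseteq> pverts G"
    using P C(1) by (auto simp: is_tree_cover_def is_clique_def)
  have fin: "finite P" using part pair_graph_finite[OF G] finite_elements by blast
  have PV: "X \<subseteq> pverts G" if "X \<in> P" for X using part that by (auto simp: partition_on_def)
  have tree: "undirected_tree (with_proj (induced G X))" if "X \<in> P" for X
    using P that by (auto simp: is_tree_cover_def induce_subgraph_with_proj)
  have sum: "(\<Sum>X\<in>P. card (X \<inter> C)) = card C"
    using sum_card_inter_partition pair_graph_finite[OF G] part CV by blast
  have le2: "card (X \<inter> C) \<le> 2" if "X \<in> P" for X
    using undirected_tree_inter_clique G C(1) P that by (auto simp: is_tree_cover_def)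
  \<comment> \<open>If every tree met \<open>C\<close> in two vertices, \<open>C\<close> would have
    \<open>2 * card P\<close> elements, one too many.\<close>
  obtain X where X: "X \<in> P" "card (X \<inter> C) < 2"
  proof (rule ccontr)
    assume "\<not> thesis"
    then have "card (X \<inter> C) = 2" if "X \<in> P" for X
      using le2 that \<open>\<And>X. X \<in> P \<Longrightarrow> card (X \<inter> C) < 2 \<Longrightarrow> thesis\<close> by force
    then show False using sum C(2) by simp
  qed
  \<comment> \<open>The other trees hold at most \<open>2 * (card P - 1)\<close>, that is
    \<open>card C - 1\<close>, vertices of \<open>C\<close>, so \<open>X\<close> holds at least
    one.\<close>
  have "card C = card (X \<inter> C) + (\<Sum>Y\<in>P - {X}. card (Y \<inter> C))"
    using sum sum.remove[OF fin X(1), of "\<lambda>Y. card (Y \<inter> C)"] by simp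
  also have "(\<Sum>Y\<in>P - {X}. card (Y \<inter> C)) \<le> (\<Sum>Y\<in>P - {X}. 2)"
    using le2 by (intro sum_mono) auto
  finally have "card C \<le> card (X \<inter> C) + 2 * (card P - 1)" using fin X(1) by simp
  moreover have "card P > 0" using fin X(1) card_gt_0_iff by blast
  ultimately have "card (X \<inter> C) = 1" using C(2) X(2) by linarith
  then obtain c where c: "X \<inter> C = {c}" by (auto simp: card_1_singleton_iff)
  have vP: "v \<notin> Y" if "Y \<in> P" for Y using PV v that by blast
  define Q where "Q = insert (insert v X) (P - {X})"
  \<comment> \<open>\<open>partition_on_insert\<close> is used twice: backwards to take
    \<open>X\<close> out of \<open>P\<close>, then forwards to put \<open>insert v X\<close> in. The
    vertices outside the exchanged block are the same in both graphs.\<close>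
  have disj: "disjnt X (\<Union>(P - {X}))"
    using partition_onD2[OF part] X(1) unfolding disjnt_def disjoint_def by blast
  have "partition_on (pverts G - X) (P - {X})"
    using part partition_on_insert[OF disj] X(1) by (simp add: insert_absorb)
  moreover have "insert v (pverts G) - insert v X = pverts G - X" using v by blast
  moreover have "disjnt (insert v X) (\<Union>(P - {X}))" using disj vP by (auto simp: disjnt_def)
  ultimately have "partition_on (insert v (pverts G)) Q"
    unfolding Q_def using PV[OF X(1)] by (simp add: partition_on_insert subset_insertI2)
  moreover have "undirected_tree (with_proj (induced ?H Y))" if "Y \<in> Q" for Y
  proof (cases "Y = insert v X")
    case True
    have "induced ?H Y = add_vert_adjacent (induced G X) v {c}"
      using induced_add_vert_adjacent_insert[OF G v CV] by (simp add: True c)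
    moreover have "undirected_tree (with_proj (add_vert_adjacent (induced G X) v {c}))"
      using c by (intro undirected_tree_add_leaf pair_graph_induced G PV tree X(1))
        (use vP X(1) in auto)
    ultimately show ?thesis by simp
  next
    case False
    then have "Y \<in> P" using that by (simp add: Q_def)
    then have "induced ?H Y = induced G Y"
      using vP by (simp add: induced_add_vert_adjacent)
    with tree \<open>Y \<in> P\<close> show ?thesis by simp
  qed
  \<comment> \<open>The new block contains \<open>v\<close>, so it differs from all remaining blocks
    and the exchange keeps the count.\<close>
  moreover have "card Q = card P"
    unfolding Q_def using fin X(1) vP card.remove[OF fin X(1)]
    by (subst card_insert_disjoint) auto
  ultimately show ?thesis
    by (auto simp: is_tree_cover_def induce_subgraph_with_proj add_vert_adjacent_def)
qed

text \<open>The number \<open>m\<close> stays fixed during the induction: each added vertex is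
  attached to a clique on \<open>k = 2 * m - 1\<close> vertices, the size at which a cover by
  \<open>m\<close> trees extends.\<close>

lemma k_tree_tree_cover:
  assumes "k_tree k G" "k + 1 = 2 * m"
  shows "\<exists>P. is_tree_cover G P \<and> card P = m"
  using assms(1)
proof induction
  case (complete G)
  then show ?case using complete_tree_cover assms(2) by metis
next
  case (add_vert G v C)
  then show ?case using tree_cover_add_vert k_tree_imp_pair_graph assms(2) by metis
qed

theorem theorem6p35:
  fixes k :: nat and G :: "'a pair_pre_digraph"
  assumes "odd k" and "k_tree k G"
  shows "tree_cover_number G = (k + 1) div 2"
proof -
  obtain m where m: "k + 1 = 2 * m" using assms(1) by (metis dvd_def even_plus_one_iff)
  obtain C where C: "is_clique G C" "card C = k + 1"
    using k_tree_has_clique assms(2) by blast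
  have "tree_cover_number G = m"
    unfolding tree_cover_number_def
  proof (rule Least_equality)
    show "\<exists>P. is_tree_cover G P \<and> card P = m"
      using k_tree_tree_cover assms(2) m by blast
  next
    fix n assume "\<exists>P. is_tree_cover G P \<and> card P = n"
    \<comment> \<open>The clique on \<open>k + 1 = 2 * m\<close> vertices forces
      \<open>2 * m \<le> 2 * n\<close>.\<close>
    then show "m \<le> n"
      using card_clique_le_tree_cover k_tree_imp_pair_graph[OF assms(2)] C m by fastforce
  qed
  then show ?thesis using m by simp
qed

end
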